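(* Let $p$ be a prime and let $\ell\neq p$ be a rational prime. Let $V$ and $W$ be finite dimensional vector spaces over $\mathbb{F}_\ell$, and let $S\in\mathrm{GL}(V)$ and $T\in\mathrm{GL}(W)$. Then the following statements are equivalent. (i) $Q(V,S)\cong Q(W,T)$ as quandles. (ii) $V\cong W$ as $\mathbb{F}_\ell[t,t^{-1}]$-modules, where $t$ acts on $V$ (resp. $W$) via $S$ (resp. $T$). (iii) There exists an isomorphism $\varphi\colon V\rightarrow W$ of $\mathbb{F}_\ell$-vector spaces such that $T\circ\varphi=\varphi\circ S$.
   Context: A quandle is a nonempty set $Q$ with a binary operation $*$ such that $x*x=x$, each map $x\mapsto x*y$ is bijective, and $(x*y)*z=(x*z)*(y*z)$; a quandle isomorphism is a bijection preserving $*$. For an abelian group $M$ and $\varphi\in\operatorname{Aut}(M)$, the Alexander quandle $Q(M,\varphi)$ is the set $M$ with $x*y=\varphi(x)+(1-\varphi)(y)$. (In the paper $p$ is the characteristic of a fixed finite base field; it plays no other role in this statement.) *)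

theory Defs
  imports Complex_Main "HOL-Library.Cardinality" "HOL-Library.Poly_Mapping" "HOL-Computational_Algebra.Primes"
begin

record 'a binary_structure =
  elems :: "'a set"
  opn :: "'a \<Rightarrow> 'a \<Rightarrow> 'a"

definition quandle :: "'a binary_structure \<Rightarrow> bool" where
  "quandle Q \<longleftrightarrow>
     elems Q \<noteq> {} \<and>
     (\<forall>x\<in>elems Q. \<forall>y\<in>elems Q. opn Q x y \<in> elems Q) \<and>
     (\<forall>x\<in>elems Q. opn Q x x = x) \<and>
     (\<forall>y\<in>elems Q. bij_betw (\<lambda>x. opn Q x y) (elems Q) (elems Q)) \<and>
     (\<forall>x\<in>elems Q. \<forall>y\<in>elems Q. \<forall>z\<in>elems Q.
        opn Q (opn Q x y) z = opn Q (opn Q x z) (opn Q y z))"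

definition quandle_isomorphic :: "'a binary_structure \<Rightarrow> 'b binary_structure \<Rightarrow> bool" where
  "quandle_isomorphic Q R \<longleftrightarrow>
     quandle Q \<and> quandle R \<and>
     (\<exists>f. bij_betw f (elems Q) (elems R) \<and>
        (\<forall>x\<in>elems Q. \<forall>y\<in>elems Q. f (opn Q x y) = opn R (f x) (f y)))"

text \<open>The abelian group \<open>M\<close> is the whole type; \<open>\<phi>\<close> is meant to be an additive bijection.\<close>

definition alexander_quandle :: "('a::ab_group_add \<Rightarrow> 'a) \<Rightarrow> 'a binary_structure" where
  "alexander_quandle \<phi> = \<lparr>elems = UNIV, opn = (\<lambda>x y. \<phi> x + (y - \<phi> y))\<rparr>"

lemma quandle_alexander_quandle:
  assumes "additive \<phi>" "bij \<phi>"
  shows "quandle (alexander_quandle \<phi>)"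
proof -
  interpret additive \<phi> by fact
  have "bij ((\<lambda>x. x + c) \<circ> \<phi>)" for c
    using \<open>bij \<phi>\<close> by (intro bij_comp bij_plus_right)
  then have "bij (\<lambda>x. \<phi> x + c)" for c
    by (simp add: comp_def)
  then show ?thesis
    unfolding quandle_def alexander_quandle_def by (simp add: add diff)
qed

definition general_linear :: "('k::field \<Rightarrow> 'v::ab_group_add \<Rightarrow> 'v) \<Rightarrow> ('v \<Rightarrow> 'v) set" where
  "general_linear scale = {S. Vector_Spaces.linear scale scale S \<and> bij S}"

definition int_funpow :: "('a \<Rightarrow> 'a) \<Rightarrow> int \<Rightarrow> 'a \<Rightarrow> 'a" where
  "int_funpow f n = (if n \<ge> 0 then f ^^ nat n else inv f ^^ nat (- n))"

text \<open>Finitely supported functions \<open>int \<Rightarrow> 'k\<close> under convolution: this is the ring \<open>k[t, t\<^sup>-\<^sup>1]\<close>,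
  with \<open>Poly_Mapping.single n c\<close> the monomial \<open>c t\<^sup>n\<close>.\<close>

type_synonym 'k laurent_poly = "int \<Rightarrow>\<^sub>0 'k"

definition laurent_action ::
  "('k::field \<Rightarrow> 'v::ab_group_add \<Rightarrow> 'v) \<Rightarrow> ('v \<Rightarrow> 'v) \<Rightarrow> 'k laurent_poly \<Rightarrow> 'v \<Rightarrow> 'v" where
  "laurent_action scale S q v =
     (\<Sum>n\<in>Poly_Mapping.keys q. scale (Poly_Mapping.lookup q n) (int_funpow S n v))"

lemma int_funpow_Suc:
  assumes "bij f"
  shows "int_funpow f (n + 1) x = f (int_funpow f n x)"
proof (cases "n \<ge> 0")
  case True
  then show ?thesis by (simp add: int_funpow_def nat_add_distrib)
next
  case False
  then obtain k where k: "n = - int (Suc k)"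
    by (metis int_cases not_less zero_le_imp_eq_int of_nat_0_le_iff)
  have "nat (- (n + 1)) = k" "nat (- n) = Suc k" using k by auto
  with False k show ?thesis
    using bij_is_surj[OF assms]
    by (auto simp: int_funpow_def surj_f_inv_f)
qed

lemma int_funpow_pred:
  assumes "bij f"
  shows "int_funpow f (n - 1) x = inv f (int_funpow f n x)"
  using int_funpow_Suc[OF assms, of "n - 1" x] bij_is_inj[OF assms] by simp

lemma int_funpow_add:
  assumes "bij f"
  shows "int_funpow f (m + n) x = int_funpow f m (int_funpow f n x)"
proof (induction m rule: int_induct[where k = 0])
  case base
  then show ?case by (simp add: int_funpow_def)
next
  case (step1 i)
  then show ?case
    using int_funpow_Suc[OF assms, of "i + n" x] int_funpow_Suc[OF assms, of i]
    by (simp add: algebra_simps)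
next
  case (step2 i)
  then show ?case
    using int_funpow_pred[OF assms, of "i + n" x] int_funpow_pred[OF assms, of i]
    by (simp add: algebra_simps)
qed

lemma laurent_action_single:
  assumes "vector_space scale"
  shows "laurent_action scale S (Poly_Mapping.single n c) v = scale c (int_funpow S n v)"
proof -
  interpret vector_space scale by fact
  show ?thesis by (simp add: laurent_action_def)
qed

lemma laurent_action_add:
  assumes "vector_space scale"
  shows "laurent_action scale S (q + r) v = laurent_action scale S q v + laurent_action scale S r v"
proof -
  interpret vector_space scale by fact
  let ?K = "Poly_Mapping.keys q \<union> Poly_Mapping.keys r"
  have *: "laurent_action scale S u v =
      (\<Sum>n\<in>?K. scale (Poly_Mapping.lookup u n) (int_funpow S n v))"
    if "Poly_Mapping.keys u \<subseteq> ?K" for u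
    unfolding laurent_action_def using that
    by (intro sum.mono_neutral_left) (auto simp: in_keys_iff)
  show ?thesis
    by (simp add: * Poly_Mapping.keys_add lookup_add scale_left_distrib sum.distrib)
qed

lemma module_laurent_action:
  fixes scale :: "'k::field \<Rightarrow> 'v::ab_group_add \<Rightarrow> 'v"
  assumes S: "S \<in> general_linear scale"
  shows "module (laurent_action scale S)"
proof -
  from S have bij: "bij S" and lin: "Vector_Spaces.linear scale scale S"
    by (auto simp: general_linear_def)
  interpret S: Vector_Spaces.linear scale scale S by fact
  have vs: "vector_space scale" by (rule S.vs1.vector_space_axioms)
  have inv_S: "inv S (S x) = x" "S (inv S x) = x" for x
    using bij by (auto simp: bij_is_inj bij_is_surj surj_f_inv_f)
  have inv_add: "inv S (x + y) = inv S x + inv S y" for x y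
    by (metis S.add inv_S)
  have inv_scale: "inv S (scale c x) = scale c (inv S x)" for c x
    by (metis S.scale inv_S)
  have funpow_add: "(f ^^ k) (x + y) = (f ^^ k) x + (f ^^ k) y"
    if "\<And>x y. f (x + y) = f x + f y" for f :: "'v \<Rightarrow> 'v" and k x y
    by (induction k) (auto simp: that)
  have funpow_scale: "(f ^^ k) (scale c x) = scale c ((f ^^ k) x)"
    if "\<And>c x. f (scale c x) = scale c (f x)" for f :: "'v \<Rightarrow> 'v" and k c x
    by (induction k) (auto simp: that)
  have pow_add: "int_funpow S n (x + y) = int_funpow S n x + int_funpow S n y" for n x y
    by (simp add: int_funpow_def funpow_add S.add inv_add)
  have pow_scale: "int_funpow S n (scale c x) = scale c (int_funpow S n x)" for n c x
    by (simp add: int_funpow_def funpow_scale S.scale inv_scale)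
  let ?act = "laurent_action scale S"
  have right: "?act q (x + y) = ?act q x + ?act q y" for q x y
    by (simp add: laurent_action_def pow_add S.vs1.scale_right_distrib sum.distrib)
  have zero: "?act q 0 = 0" for q using right[of q 0 0] by simp
  have sum_singles: "q = (\<Sum>n\<in>Poly_Mapping.keys q. Poly_Mapping.single n (Poly_Mapping.lookup q n))"
    for q :: "'k laurent_poly"
    by (rule poly_mapping_eqI)
      (auto simp: lookup_sum lookup_single when_def in_keys_iff sum.delta if_distrib cong: if_cong)
  have ind: "P q"
    if "P 0" "\<And>n c. P (Poly_Mapping.single n c)" "\<And>q r. P q \<Longrightarrow> P r \<Longrightarrow> P (q + r)"
    for P and q :: "'k laurent_poly"
  proof -
    have "P (\<Sum>n\<in>A. Poly_Mapping.single n (Poly_Mapping.lookup q n))" if "finite A" for A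
      using that by (induction A) (simp_all add: \<open>P 0\<close> that \<open>\<And>n c. P (Poly_Mapping.single n c)\<close>
        \<open>\<And>q r. P q \<Longrightarrow> P r \<Longrightarrow> P (q + r)\<close>)
    then show ?thesis by (subst sum_singles) simp
  qed
  have single_single: "?act (Poly_Mapping.single m a) (?act (Poly_Mapping.single n b) x) =
      ?act (Poly_Mapping.single m a * Poly_Mapping.single n b) x" for m a n b x
    by (simp add: laurent_action_single[OF vs] mult_single int_funpow_add[OF bij] pow_scale)
  have zero_left: "?act 0 x = 0" for x by (simp add: laurent_action_def)
  have single: "?act (Poly_Mapping.single m a) (?act r x) = ?act (Poly_Mapping.single m a * r) x"
    for m a r x
    by (rule ind[of "\<lambda>r. ?act (Poly_Mapping.single m a) (?act r x) = ?act (Poly_Mapping.single m a * r) x"])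
      (simp_all add: zero zero_left single_single laurent_action_add[OF vs] right distrib_left)
  have mult: "?act q (?act r x) = ?act (q * r) x" for q r x
    by (rule ind[of "\<lambda>q. ?act q (?act r x) = ?act (q * r) x"])
      (simp_all add: zero_left single laurent_action_add[OF vs] distrib_right)
  show ?thesis
  proof
    show "?act 1 x = x" for x
      using laurent_action_single[OF vs, of S 0 1 x] by (simp add: int_funpow_def)
  qed (simp_all add: right laurent_action_add[OF vs] mult)
qed

lemma laurent_action_const:
  assumes "vector_space scale"
  shows "laurent_action scale S (Poly_Mapping.single 0 c) = scale c"
  by (rule ext) (simp add: laurent_action_single[OF assms] int_funpow_def)

lemma laurent_action_t:
  assumes "vector_space scale"
  shows "laurent_action scale S (Poly_Mapping.single 1 1) = S"
proof -
  interpret vector_space scale by fact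
  show ?thesis
    by (rule ext) (simp add: laurent_action_single[OF assms] int_funpow_def)
qed

end

theory Submission
  imports Defs "HOL-Number_Theory.Cong"
begin

text \<open>
  Normalise a quandle isomorphism so that \<open>f 0 = 0\<close>. Putting \<open>y = 0\<close> or \<open>x = 0\<close> in the homomorphism
  law shows that \<open>f\<close> intertwines \<open>S\<close> with \<open>T\<close> and \<open>A = 1 - S\<close> with \<open>B = 1 - T\<close>, whence \<open>f\<close> is additive
  on the image of \<open>A\<close>; over a prime field it is therefore linear there. The bijection \<open>f\<close> also maps
  \<open>U = im A + ker A\<close> onto \<open>U' = im B + ker B\<close>, because these are the preimages of \<open>im A\<^sup>2\<close> under \<open>A\<close> and
  of \<open>im B\<^sup>2\<close> under \<open>B\<close>, so \<open>U\<close> and \<open>U'\<close> have the same dimension. Now take a basis of \<open>im A\<close>, extend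
  it by vectors of \<open>ker A\<close> to a basis of \<open>U\<close>, and then to a basis of \<open>V\<close>. A linear map that agrees
  with \<open>f\<close> on the first and third part of this basis and sends the second part bijectively to an
  analogous subset of \<open>ker B\<close> intertwines \<open>A\<close> and \<open>B\<close>. It is injective: if it kills \<open>v\<close>, it kills \<open>A v\<close>,
  so \<open>A v = 0\<close> and \<open>v \<in> U\<close>, where it is injective.
\<close>

section \<open>Prime fields and spans over finite fields\<close>

text \<open>Translation by 1 permutes the field, so summing all elements shows that the cardinality
  is zero in the field. Hence the characteristic divides this prime and equals it, and the multiples
  of 1 below it are distinct and exhaust the field.\<close>

lemma of_nat_surj_prime_card:
  assumes "prime (CARD('k::field))"
  shows "surj (of_nat :: nat \<Rightarrow> 'k)"
proof -
  have fin: "finite (UNIV :: 'k set)"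
    using assms by (metis card.infinite not_prime_0)
  have "(\<Sum>x\<in>UNIV. x + (1 :: 'k)) = \<Sum>UNIV"
    by (rule sum.reindex_bij_witness[of _ "\<lambda>x. x - 1" "\<lambda>x. x + 1"]) auto
  then have "of_nat (CARD('k)) = (0 :: 'k)"
    by (simp add: sum.distrib)
  then have "CHAR('k) dvd CARD('k)"
    by (simp add: of_nat_eq_0_iff_char_dvd)
  then have "CHAR('k) = CARD('k)"
    using assms CHAR_not_1' by (metis One_nat_def prime_nat_iff)
  then have "inj_on (of_nat :: nat \<Rightarrow> 'k) {..<CARD('k)}"
    by (intro inj_onI) (auto simp: of_nat_eq_iff_cong_CHAR cong_def)
  then have "of_nat ` {..<CARD('k)} = (UNIV :: 'k set)"
    using fin by (intro card_subset_eq) (auto simp: card_image)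
  then show ?thesis by blast
qed

context vector_space
begin

text \<open>Lets dimensions be compared by counting. A vector in the span of
  \<open>insert a X\<close> is determined by its coefficient at \<open>a\<close> and its remainder
  in \<open>span X\<close>.\<close>

lemma finite_card_span:
  assumes "finite (UNIV :: 'a set)" "finite X" "independent X"
  shows "finite (span X) \<and> card (span X) = CARD('a) ^ card X"
  using assms(2,3)
proof (induction X)
  case empty
  then show ?case by simp
next
  case (insert a X)
  then have a: "a \<notin> span X" and X: "independent X"
    by (simp_all add: independent_insert)
  let ?g = "\<lambda>(c, v). scale c a + v"
  have inj: "inj_on ?g (UNIV \<times> span X)"
  proof (rule inj_onI, clarify)
    fix c v d w
    assume v: "v \<in> span X" and w: "w \<in> span X" and eq: "scale c a + v = scale d a + w"
    have "scale (c - d) a = w - v"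
      using eq by (simp add: scale_left_diff_distrib algebra_simps)
    then have "scale (c - d) a \<in> span X"
      using v w by (simp add: span_diff)
    \<comment> \<open>Otherwise dividing by \<open>c - d\<close> would put \<open>a\<close> into
      \<open>span X\<close>.\<close>
    then have "c = d"
      using span_scale[of "scale (c - d) a" X "inverse (c - d)"] a by (cases "c = d") auto
    then show "c = d \<and> v = w" using eq by simp
  qed
  have "span (insert a X) = ?g ` (UNIV \<times> span X)"
  proof (intro equalityI subsetI)
    fix x assume "x \<in> span (insert a X)"
    then obtain k where "x - scale k a \<in> span X"
      by (auto simp: span_insert)
    then show "x \<in> ?g ` (UNIV \<times> span X)"
      by (intro image_eqI[of _ _ "(k, x - scale k a)"]) auto
  next
    fix x assume "x \<in> ?g ` (UNIV \<times> span X)"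
    then obtain c v where "x = scale c a + v" "v \<in> span X" by auto
    then show "x \<in> span (insert a X)"
      by (auto simp: span_insert intro!: exI[of _ c])
  qed
  then show ?case
    using insert.IH[OF X] inj assms(1) insert.hyps
    by (simp add: card_image card_cartesian_product finite_cartesian_product)
qed

text \<open>The condition \<open>A v \<in> range (A \<circ> A)\<close> says that \<open>v\<close> lies in \<open>im A + ker A\<close>.\<close>

lemma image_kernel_basis:
  assumes A: "Vector_Spaces.linear scale scale A" and X: "independent X" "span X = range A"
  obtains K where "X \<inter> K = {}" "independent (X \<union> K)" "\<And>k. k \<in> K \<Longrightarrow> A k = 0"
    "span (X \<union> K) = {v. A v \<in> range (A \<circ> A)}"
proof -
  interpret A: Vector_Spaces.linear scale scale A by fact
  let ?U = "{v. A v \<in> range (A \<circ> A)}"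
  \<comment> \<open>Extending \<open>X\<close> only by kernel vectors makes \<open>A\<close> vanish
    on the new part \<open>Y - X\<close>, which becomes \<open>K\<close>.\<close>
  have "X \<subseteq> X \<union> {v. A v = 0}" by blast
  from maximal_independent_subset_extend[OF this X(1)]
  obtain Y where Y: "X \<subseteq> Y" "Y \<subseteq> X \<union> {v. A v = 0}" "independent Y" "X \<union> {v. A v = 0} \<subseteq> span Y"
    by blast
  have XA: "x \<in> range A" if "x \<in> X" for x
    using that X(2) span_base by blast
  have "subspace ?U"
  proof (rule subspaceI)
    show "0 \<in> ?U" by (auto simp: A.zero intro: image_eqI[of _ _ 0])
    show "x + y \<in> ?U" if "x \<in> ?U" "y \<in> ?U" for x y
      using that by (auto simp: A.add) (metis A.add rangeI)
    show "scale c x \<in> ?U" if "x \<in> ?U" for c x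
      using that by (auto simp: A.scale) (metis A.scale rangeI)
  qed
  moreover have "Y \<subseteq> ?U"
  proof
    fix y assume "y \<in> Y"
    then have "y \<in> X \<or> A y = 0" using Y(2) by blast
    then show "y \<in> ?U"
      using XA by (auto simp: image_iff) (metis A.zero)
  qed
  ultimately have "span Y \<subseteq> ?U" by (simp add: span_minimal)
  moreover have "?U \<subseteq> span Y"
  proof
    fix v assume "v \<in> ?U"
    then obtain u where "A v = A (A u)" by auto
    then have "v - A u \<in> span Y" using Y(4) by (auto simp: A.diff)
    moreover have "A u \<in> span Y" using X(2) span_mono[OF Y(1)] by blast
    ultimately have "v - A u + A u \<in> span Y" by (rule span_add)
    then show "v \<in> span Y" by simp
  qed
  ultimately show thesis
    using Y by (intro that[of "Y - X"]) (auto simp: Un_absorb1)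
qed

end

section \<open>From a bijection to a linear intertwiner\<close>

context vector_space_pair
begin

text \<open>In the application \<open>A = 1 - S\<close> and \<open>B = 1 - T\<close>, so
  intertwining these amounts to intertwining \<open>S\<close> and \<open>T\<close>. Linearity of
  \<open>f\<close> is available only on \<open>range A\<close>; elsewhere \<open>f\<close> may have
  to be replaced.\<close>

lemma linear_intertwiner_of_bij:
  assumes finV: "finite (UNIV :: 'b set)" and fink: "finite (UNIV :: 'a set)"
    and A: "Vector_Spaces.linear s1 s1 A" and B: "Vector_Spaces.linear s2 s2 B"
    and f: "bij f" and fA: "\<And>v. f (A v) = B (f v)"
    and f_add: "\<And>u v. f (A u + A v) = f (A u) + f (A v)"
    and f_scale: "\<And>c v. f (s1 c (A v)) = s2 c (f (A v))"
  obtains \<phi> where "Vector_Spaces.linear s1 s2 \<phi>" "bij \<phi>" "\<And>v. \<phi> (A v) = B (\<phi> v)"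
proof -
  interpret A: Vector_Spaces.linear s1 s1 A by fact
  interpret B: Vector_Spaces.linear s2 s2 B by fact
  have finW: "finite (UNIV :: 'c set)"
    using finV f by (metis bij_betw_finite)
  have f0: "f 0 = 0" using f_add[of 0 0] by (simp add: A.zero)
  have inj_f: "inj f" and surj_f: "surj f"
    using f by (auto simp: bij_def)
  have f_range: "f ` range A = range B"
    using surj_f by (auto simp: fA) (metis fA rangeI surj_def image_eqI)
  \<comment> \<open>Stated for arbitrary \<open>h\<close>, since it serves both for the auxiliary
    map on \<open>range A\<close> and for the final \<open>\<phi>\<close>.\<close>
  have agree: "h x = f x"
    if "Vector_Spaces.linear s1 s2 h" "\<And>x. x \<in> X \<Longrightarrow> h x = f x" "vs1.span X = range A" "x \<in> range A" for h X x
  proof -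
    interpret h: Vector_Spaces.linear s1 s2 h by fact
    have "vs1.subspace {x \<in> range A. h x = f x}"
    proof (rule vs1.subspaceI)
      show "0 \<in> {x \<in> range A. h x = f x}"
        using f0 h.zero A.zero by (auto intro: image_eqI[of _ _ 0])
      show "x + y \<in> {x \<in> range A. h x = f x}"
        if "x \<in> {x \<in> range A. h x = f x}" "y \<in> {x \<in> range A. h x = f x}" for x y
        using that by (auto simp: h.add f_add) (metis A.add rangeI)
      show "s1 c x \<in> {x \<in> range A. h x = f x}" if "x \<in> {x \<in> range A. h x = f x}" for c x
        using that by (auto simp: h.scale f_scale) (metis A.scale rangeI)
    qed
    moreover have "X \<subseteq> {x \<in> range A. h x = f x}"
      using that(2,3) vs1.span_base[of _ X] by auto
    ultimately have "vs1.span X \<subseteq> {x \<in> range A. h x = f x}"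
      by (simp add: vs1.span_minimal)
    then show ?thesis using that(3,4) by blast
  qed

  obtain X where X: "X \<subseteq> range A" "vs1.independent X" "range A \<subseteq> vs1.span X"
    using vs1.maximal_independent_subset by blast
  have span_X: "vs1.span X = range A"
    using X A.subspace_image[OF vs1.subspace_UNIV] by (metis vs1.span_subspace)
  \<comment> \<open>A globally linear stand-in for \<open>f\<close> on \<open>range A\<close>, used
    to see that \<open>f\<close> takes the basis \<open>X\<close> of \<open>range A\<close> to a
    basis of \<open>range B\<close>.\<close>
  obtain h where h: "Vector_Spaces.linear s1 s2 h" and hX: "\<And>x. x \<in> X \<Longrightarrow> h x = f x"
    using linear_independent_extend[OF X(2), of f] by blast
  have h_eq: "h x = f x" if "x \<in> range A" for x
    using agree[OF h hX span_X that] .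
  have inj_h: "inj_on h (vs1.span X)"
    unfolding span_X using inj_f by (auto simp: inj_on_def h_eq)
  have fX: "f ` X = h ` X" using hX by auto
  have ind_fX: "vs2.independent (f ` X)"
    unfolding fX using h X(2) inj_h by (rule linear_independent_injective_image)
  have span_fX: "vs2.span (f ` X) = range B"
    unfolding fX linear_span_image[OF h] span_X using f_range h_eq by auto

  obtain K where K: "X \<inter> K = {}" "vs1.independent (X \<union> K)" "\<And>k. k \<in> K \<Longrightarrow> A k = 0"
    "vs1.span (X \<union> K) = {v. A v \<in> range (A \<circ> A)}"
    using vs1.image_kernel_basis[OF A X(2) span_X] by blast
  obtain L where L: "f ` X \<inter> L = {}" "vs2.independent (f ` X \<union> L)" "\<And>k. k \<in> L \<Longrightarrow> B k = 0"
    "vs2.span (f ` X \<union> L) = {v. B v \<in> range (B \<circ> B)}"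
    using vs2.image_kernel_basis[OF B ind_fX span_fX] by blast
  have fin: "finite X" "finite K" "finite L"
    using finV finW by (auto intro: finite_subset)

  have "f v \<in> {v. B v \<in> range (B \<circ> B)} \<longleftrightarrow> A v \<in> range (A \<circ> A)" for v
  proof
    assume "f v \<in> {v. B v \<in> range (B \<circ> B)}"
    then obtain u where "B (f v) = B (B (f u))" using surj_f by auto (metis surjD)
    then have "f (A v) = f (A (A u))" by (simp add: fA)
    then show "A v \<in> range (A \<circ> A)" using inj_f by (auto dest: injD)
  next
    assume "A v \<in> range (A \<circ> A)"
    then obtain u where "A v = A (A u)" by auto
    then have "B (f v) = B (B (f u))" by (metis fA)
    then show "f v \<in> {v. B v \<in> range (B \<circ> B)}" by auto
  qed
  then have "f ` vs1.span (X \<union> K) = vs2.span (f ` X \<union> L)"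
    unfolding K(4) L(4) using surj_f by (auto simp: image_iff) (metis surjD)
  \<comment> \<open>\<open>f\<close> is not known to be linear on this span, so the dimensions are
    compared through cardinalities.\<close>
  then have "card (vs1.span (X \<union> K)) = card (vs2.span (f ` X \<union> L))"
    using inj_f by (metis card_image inj_on_subset subset_UNIV)
  moreover have "CARD('a) > 1"
    using card_mono[OF fink, of "{0, 1}"] by simp
  ultimately have "card (X \<union> K) = card (f ` X \<union> L)"
    using vs1.finite_card_span[OF fink _ K(2)] vs2.finite_card_span[OF fink _ L(2)] fin by simp
  then have "card K = card L"
    using fin K(1) L(1) inj_f by (simp add: card_Un_disjoint card_image inj_on_subset)
  then obtain j where j: "bij_betw j K L"
    using fin finite_same_card_bij by blast

  obtain E where E: "X \<union> K \<subseteq> E" "vs1.independent E" "vs1.span E = UNIV"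
    using vs1.extend_basis_superset[OF K(2)] vs1.independent_extend_basis[OF K(2)]
      vs1.span_extend_basis[OF K(2)] by blast
  \<comment> \<open>\<open>f\<close> maps \<open>K\<close> into the kernel of \<open>B\<close>, but
    its values there are not known to be independent of the image of \<open>X\<close>; hence
    \<open>j\<close> on \<open>K\<close>.\<close>
  define g where "g x = (if x \<in> K then j x else f x)" for x
  obtain \<phi> where \<phi>: "Vector_Spaces.linear s1 s2 \<phi>" and \<phi>E: "\<And>x. x \<in> E \<Longrightarrow> \<phi> x = g x"
    using linear_independent_extend[OF E(2), of g] by blast
  interpret \<phi>: Vector_Spaces.linear s1 s2 \<phi> by fact
  have \<phi>X: "\<phi> x = f x" if "x \<in> X" for x
    using that E(1) K(1) by (subst \<phi>E) (auto simp: g_def)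
  have \<phi>K: "\<phi> x = j x" if "x \<in> K" for x
    using that E(1) by (subst \<phi>E) (auto simp: g_def)
  have \<phi>A: "\<phi> (A v) = f (A v)" for v
    using agree[OF \<phi> \<phi>X span_X] by blast
  have comm: "\<phi> (A v) = B (\<phi> v)" for v
  proof -
    have "(\<phi> \<circ> A) v = (B \<circ> \<phi>) v"
    proof (rule linear_eq_on)
      show "Vector_Spaces.linear s1 s2 (\<phi> \<circ> A)" "Vector_Spaces.linear s1 s2 (B \<circ> \<phi>)"
        using A B \<phi> by (auto intro!: Vector_Spaces.linear_compose)
      show "v \<in> vs1.span E" by (simp add: E(3))
      fix x assume x: "x \<in> E"
      show "(\<phi> \<circ> A) x = (B \<circ> \<phi>) x"
      \<comment> \<open>On \<open>K\<close> both sides vanish. On the rest of \<open>E\<close>,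
        \<open>\<phi>\<close> agrees with \<open>f\<close> at \<open>x\<close> and at
        \<open>A x\<close>, so \<open>fA\<close> applies.\<close>
      proof (cases "x \<in> K")
        case True
        then have "j x \<in> L" using j by (auto simp: bij_betw_def)
        then show ?thesis using True K(3) L(3) by (simp add: \<phi>K \<phi>.zero)
      next
        case False
        then show ?thesis using x by (simp add: \<phi>A fA \<phi>E g_def)
      qed
    qed
    then show ?thesis by simp
  qed
  have img: "\<phi> ` (X \<union> K) = f ` X \<union> L"
    using j by (auto simp: image_Un \<phi>X \<phi>K bij_betw_def)
  \<comment> \<open>A surjection between finite sets of equal size is injective; independence of the
    image then extends injectivity to the span.\<close>
  have "inj_on \<phi> (X \<union> K)"
    using fin \<open>card (X \<union> K) = card (f ` X \<union> L)\<close> by (intro eq_card_imp_inj_on) (auto simp: img)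
  then have inj_U: "inj_on \<phi> (vs1.span (X \<union> K))"
    using \<phi> L(2) by (intro linear_inj_on_span_independent_image) (auto simp: img)
  have "inj \<phi>"
  proof (subst \<phi>.inj_iff_eq_0, intro allI impI)
    fix v assume v: "\<phi> v = 0"
    then have "f (A v) = 0" using comm[of v] by (simp add: \<phi>A B.zero)
    then have "A v = 0" using f0 inj_f by (metis injD)
    then have "v \<in> vs1.span (X \<union> K)"
      unfolding K(4) by (auto simp: A.zero intro!: image_eqI[of _ _ 0])
    then show "v = 0"
      using inj_U v \<phi>.zero vs1.span_zero by (metis inj_onD)
  qed
  moreover have "CARD('b) = CARD('c)"
    using f by (rule bij_betw_same_card)
  ultimately have "bij \<phi>"
    using finW by (metis bij_def card_image card_subset_eq subset_UNIV)
  with \<phi> show thesis using comm by (rule that)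
qed

end

section \<open>Additive maps and Alexander quandle isomorphisms\<close>

text \<open>Every scalar is a sum of ones, so additivity suffices. It is required only on a
  subspace, because it will be applied to \<open>range A\<close>.\<close>

lemma additive_homogeneous_prime_card:
  fixes s1 :: "'k::field \<Rightarrow> 'v::ab_group_add \<Rightarrow> 'v" and s2 :: "'k \<Rightarrow> 'w::ab_group_add \<Rightarrow> 'w"
  assumes "vector_space s1" "vector_space s2" "prime (CARD('k))"
    and V: "module.subspace s1 V" "v \<in> V"
    and add: "\<And>x y. x \<in> V \<Longrightarrow> y \<in> V \<Longrightarrow> f (x + y) = f x + f y"
  shows "f (s1 c v) = s2 c (f v)"
proof -
  interpret s1: vector_space s1 by fact
  interpret s2: vector_space s2 by fact
  have f0: "f 0 = 0" using add[of 0 0] s1.subspace_0[OF V(1)] by simp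
  have "f (s1 (of_nat n) v) = s2 (of_nat n) (f v)" for n
  proof (induction n)
    case 0
    then show ?case using f0 by simp
  next
    case (Suc n)
    have "f (v + s1 (of_nat n) v) = f v + f (s1 (of_nat n) v)"
      using V by (intro add s1.subspace_scale)
    with Suc show ?case by (simp add: s1.scale_left_distrib s2.scale_left_distrib)
  qed
  moreover obtain n where "c = of_nat n"
    using of_nat_surj_prime_card[OF assms(3)] by (metis surjD)
  ultimately show ?thesis by simp
qed

text \<open>The first summand \<open>u\<close> in the additivity law is arbitrary because
  surjectivity of \<open>S\<close> allows writing it as \<open>S x\<close>.\<close>

lemma alexander_quandle_isomorphicE:
  assumes "quandle_isomorphic (alexander_quandle S) (alexander_quandle T)"
    and S: "additive S" "surj S" and T: "additive T"
  obtains f where "bij f" "\<And>v. f (v - S v) = f v - T (f v)"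
    "\<And>u v. f (u + (v - S v)) = f u + f (v - S v)"
proof -
  interpret S: additive S by fact
  interpret T: additive T by fact
  obtain g where g: "bij g" and hom: "\<And>x y. g (S x + (y - S y)) = T (g x) + (g y - T (g y))"
    using assms(1) by (auto simp: quandle_isomorphic_def alexander_quandle_def)
  define f where "f x = g x - g 0" for x
  have "bij ((\<lambda>x. x + - g 0) \<circ> g)"
    using g by (intro bij_comp bij_plus_right)
  then have "bij f" by (simp add: f_def[abs_def] comp_def)
  have f0: "f 0 = 0" by (simp add: f_def)
  \<comment> \<open>The translation by \<open>g 0\<close> drops out since
    \<open>g 0 = T (g 0) + (g 0 - T (g 0))\<close>.\<close>
  have f_hom: "f (S x + (y - S y)) = T (f x) + (f y - T (f y))" for x y
    unfolding f_def hom by (simp add: T.diff)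
  have f1: "f (v - S v) = f v - T (f v)" for v
    using f_hom[of 0 v] by (simp add: f0 S.zero T.zero)
  have f2: "f (S x) = T (f x)" for x
    using f_hom[of x 0] by (simp add: f0 S.zero T.zero)
  have "f (u + (v - S v)) = f u + f (v - S v)" for u v
  proof -
    obtain x where "u = S x" using S(2) by (metis surjD)
    then show ?thesis by (simp add: f_hom f1 f2)
  qed
  with \<open>bij f\<close> f1 show thesis by (rule that)
qed

lemma alexander_quandle_isomorphicI:
  assumes "additive S" "bij S" "additive T" "bij T" "additive f" "bij f" "T \<circ> f = f \<circ> S"
  shows "quandle_isomorphic (alexander_quandle S) (alexander_quandle T)"
proof -
  interpret f: additive f by fact
  have comm: "f (S x) = T (f x)" for x
    using assms(7) by (metis comp_apply)
  show ?thesis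
    unfolding quandle_isomorphic_def
    using quandle_alexander_quandle[OF assms(1,2)] quandle_alexander_quandle[OF assms(3,4)] assms(6)
    by (auto simp: alexander_quandle_def f.add f.diff comm intro!: exI[of _ f])
qed

section \<open>Homomorphisms of Laurent polynomial modules\<close>

lemma int_funpow_intertwine:
  assumes "bij S" "bij T" "T \<circ> f = f \<circ> S"
  shows "f (int_funpow S n v) = int_funpow T n (f v)"
proof -
  have comm: "f (S x) = T (f x)" for x
    using assms(3) by (metis comp_apply)
  have comm': "f (inv S x) = inv T (f x)" for x
    using assms(1,2) comm[of "inv S x"] by (simp add: bij_is_surj bij_is_inj surj_f_inv_f)
  have "f ((S ^^ k) v) = (T ^^ k) (f v)" "f ((inv S ^^ k) v) = (inv T ^^ k) (f v)" for k
    by (induction k) (simp_all add: comm comm')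
  then show ?thesis by (simp add: int_funpow_def)
qed

text \<open>Constants and the monomial \<open>t\<close> already detect linearity and intertwining.
  Conversely, an intertwiner commutes with all integer powers, hence with their linear combinations.
  The same map works on both sides, so bijectivity carries over.\<close>

lemma module_hom_laurent_action_iff:
  assumes S: "S \<in> general_linear scaleV" and T: "T \<in> general_linear scaleW"
  shows "module_hom (laurent_action scaleV S) (laurent_action scaleW T) f \<longleftrightarrow>
    Vector_Spaces.linear scaleV scaleW f \<and> T \<circ> f = f \<circ> S"
proof -
  have vs: "vector_space scaleV" "vector_space scaleW" and bij: "bij S" "bij T"
    using S T by (auto simp: general_linear_def Vector_Spaces.linear_def)
  note mods = module_laurent_action[OF S] module_laurent_action[OF T]
  show ?thesis
  proof
    assume "module_hom (laurent_action scaleV S) (laurent_action scaleW T) f"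
    then interpret f: module_hom "laurent_action scaleV S" "laurent_action scaleW T" f .
    have "f (scaleV c v) = scaleW c (f v)" for c v
      using f.scale[of "Poly_Mapping.single 0 c" v]
      by (simp add: laurent_action_const vs)
    moreover have "f (S v) = T (f v)" for v
      using f.scale[of "Poly_Mapping.single 1 1" v]
      by (simp add: laurent_action_t vs)
    ultimately show "Vector_Spaces.linear scaleV scaleW f \<and> T \<circ> f = f \<circ> S"
      using vs f.add by (auto simp: Vector_Spaces.linear_iff fun_eq_iff)
  next
    assume *: "Vector_Spaces.linear scaleV scaleW f \<and> T \<circ> f = f \<circ> S"
    then interpret f: Vector_Spaces.linear scaleV scaleW f by blast
    have "f (int_funpow S n v) = int_funpow T n (f v)" for n v
      using int_funpow_intertwine[OF bij] * by blast
    then have "f (laurent_action scaleV S q v) = laurent_action scaleW T q (f v)" for q v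
      by (simp add: laurent_action_def f.sum f.scale)
    then show "module_hom (laurent_action scaleV S) (laurent_action scaleW T) f"
      using mods f.add by (simp add: module_hom_iff)
  qed
qed

section \<open>Equivalence of the three kinds of isomorphism\<close>

theorem theorem4p2:
  fixes p l :: nat
    and scaleV :: "'k::field \<Rightarrow> 'v::ab_group_add \<Rightarrow> 'v"
    and scaleW :: "'k \<Rightarrow> 'w::ab_group_add \<Rightarrow> 'w"
    and S :: "'v \<Rightarrow> 'v"
    and T :: "'w \<Rightarrow> 'w"
  assumes "prime p" and "prime l" and "l \<noteq> p"
    and "CARD('k) = l"
    and "\<exists>B. finite_dimensional_vector_space scaleV B"
    and "\<exists>B. finite_dimensional_vector_space scaleW B"
    and "S \<in> general_linear scaleV"
    and "T \<in> general_linear scaleW"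
  shows "(quandle_isomorphic (alexander_quandle S) (alexander_quandle T) \<longleftrightarrow>
          (\<exists>f. module_hom (laurent_action scaleV S) (laurent_action scaleW T) f \<and> bij f))
       \<and> ((\<exists>f. module_hom (laurent_action scaleV S) (laurent_action scaleW T) f \<and> bij f) \<longleftrightarrow>
          (\<exists>\<phi>. Vector_Spaces.linear scaleV scaleW \<phi> \<and> bij \<phi> \<and> T \<circ> \<phi> = \<phi> \<circ> S))"
proof -
  have linS: "Vector_Spaces.linear scaleV scaleV S" and bijS: "bij S"
    and linT: "Vector_Spaces.linear scaleW scaleW T" and bijT: "bij T"
    using assms(7,8) by (auto simp: general_linear_def)
  interpret S: Vector_Spaces.linear scaleV scaleV S by fact
  interpret T: Vector_Spaces.linear scaleW scaleW T by fact
  interpret VW: vector_space_pair scaleV scaleW by unfold_locales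
  have addS: "additive S" and addT: "additive T"
    by (simp_all add: additive_def S.add T.add)
  have prime: "prime (CARD('k))" using assms by simp
  then have fink: "finite (UNIV :: 'k set)"
    by (metis card.infinite not_prime_0)
  have finV: "finite (UNIV :: 'v set)"
  proof -
    from assms(5) obtain E where "finite_dimensional_vector_space scaleV E" ..
    then interpret V: finite_dimensional_vector_space scaleV E .
    show ?thesis
      using S.vs1.finite_card_span[OF fink V.finite_Basis V.independent_Basis] V.span_Basis by simp
  qed
  have linear: "\<exists>\<phi>. Vector_Spaces.linear scaleV scaleW \<phi> \<and> bij \<phi> \<and> T \<circ> \<phi> = \<phi> \<circ> S"
    if iso: "quandle_isomorphic (alexander_quandle S) (alexander_quandle T)"
  proof -
    define A where "A v = v - S v" for v
    define B where "B w = w - T w" for w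
    have A: "Vector_Spaces.linear scaleV scaleV A"
      by unfold_locales (simp_all add: A_def S.add S.scale algebra_simps S.vs1.scale_right_diff_distrib)
    have B: "Vector_Spaces.linear scaleW scaleW B"
      by unfold_locales (simp_all add: B_def T.add T.scale algebra_simps T.vs1.scale_right_diff_distrib)
    obtain f where f: "bij f" and fA: "\<And>v. f (A v) = B (f v)"
      and f_add: "\<And>u v. f (u + A v) = f u + f (A v)"
      using alexander_quandle_isomorphicE[OF iso addS bij_is_surj[OF bijS] addT]
      unfolding A_def B_def by blast
    interpret A: Vector_Spaces.linear scaleV scaleV A by fact
    \<comment> \<open>The subspace on which \<open>f\<close> is additive is \<open>range A\<close>,
      the image of the whole space.\<close>
    have "f (scaleV c (A v)) = scaleW c (f (A v))" for c v
      using S.vs1.vector_space_axioms T.vs1.vector_space_axioms prime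
        A.subspace_image[OF S.vs1.subspace_UNIV]
      by (rule additive_homogeneous_prime_card) (auto simp: f_add)
    then obtain \<phi> where \<phi>: "Vector_Spaces.linear scaleV scaleW \<phi>" "bij \<phi>"
      and comm: "\<And>v. \<phi> (A v) = B (\<phi> v)"
      using VW.linear_intertwiner_of_bij[OF finV fink A B f fA f_add] by blast
    interpret \<phi>: Vector_Spaces.linear scaleV scaleW \<phi> by fact
    \<comment> \<open>Expanding \<open>A\<close> and \<open>B\<close> leaves the common term
      \<open>\<phi> v\<close> on both sides, which cancels.\<close>
    have "T \<circ> \<phi> = \<phi> \<circ> S"
      using comm by (auto simp: A_def B_def \<phi>.diff)
    with \<phi> show ?thesis by blast
  qed
  have quandle: "quandle_isomorphic (alexander_quandle S) (alexander_quandle T)"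
    if "Vector_Spaces.linear scaleV scaleW \<phi>" "bij \<phi>" "T \<circ> \<phi> = \<phi> \<circ> S" for \<phi>
  proof -
    interpret \<phi>: Vector_Spaces.linear scaleV scaleW \<phi> by fact
    show ?thesis
      using addS bijS addT bijT _ that(2,3)
      by (rule alexander_quandle_isomorphicI) (simp add: additive_def \<phi>.add)
  qed
  show ?thesis
    using linear quandle module_hom_laurent_action_iff[OF assms(7,8)] by blast
qed

end
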